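(* Let $a<b$ and $c<d$ be real numbers, and let $f:[a,b]\times[c,d]\to\mathbb{R}$ be an absolutely continuous function such that the second-order partial derivative $\frac{\partial^2 f(t,s)}{\partial t\,\partial s}$ exists for all $(t,s)\in[a,b]\times[c,d]$ and is bounded, i.e. $$\left\Vert \frac{\partial^2 f(t,s)}{\partial t\,\partial s}\right\Vert_\infty=\sup_{(t,s)\in(a,b)\times(c,d)}\left\vert\frac{\partial^2 f(t,s)}{\partial t\,\partial s}\right\vert<\infty .$$ Then for all $(\alpha_1,\alpha_2),(\beta_1,\beta_2)\in[a,b]\times[c,d]$ with $\alpha_1<\beta_1$ and $\alpha_2<\beta_2$, $$\begin{aligned} &\Bigg\vert (\beta_1-\alpha_1)(\beta_2-\alpha_2)f\left(\tfrac{a+b}{2},\tfrac{c+d}{2}\right)+H(\alpha_1,\alpha_2,\beta_1,\beta_2)+G(\alpha_1,\alpha_2,\beta_1,\beta_2)\\ &\quad-(\beta_2-\alpha_2)\int_a^b f\left(t,\tfrac{c+d}{2}\right)dt-(\beta_1-\alpha_1)\int_c^d f\left(\tfrac{a+b}{2},s\right)ds\\ &\quad-\int_a^b\big[(\alpha_2-c)f(t,c)+(d-\beta_2)f(t,d)\big]dt-\int_c^d\big[(\alpha_1-a)f(a,s)+(b-\beta_1)f(b,s)\big]ds\\ &\quad+\int_a^b\int_c^d f(t,s)\,ds\,dt\Bigg\vert\\ &\le\left[\frac{(\alpha_1-a)^2+(b-\beta_1)^2}{2}+\frac{(a+b-2\alpha_1)^2+(a+b-2\beta_1)^2}{8}\right]\\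 &\quad\times\left[\frac{(\alpha_2-c)^2+(d-\beta_2)^2}{2}+\frac{(c+d-2\alpha_2)^2+(c+d-2\beta_2)^2}{8}\right]\left\Vert \frac{\partial^2 f(t,s)}{\partial t\,\partial s}\right\Vert_\infty, \end{aligned}$$ where $$H(\alpha_1,\alpha_2,\beta_1,\beta_2)=(\alpha_1-a)\big[(\alpha_2-c)f(a,c)+(d-\beta_2)f(a,d)\big]+(b-\beta_1)\big[(\alpha_2-c)f(b,c)+(d-\beta_2)f(b,d)\big]$$ and $$\begin{aligned}G(\alpha_1,\alpha_2,\beta_1,\beta_2)={}&(\beta_1-\alpha_1)\left[(\alpha_2-c)f\left(\tfrac{a+b}{2},c\right)+(d-\beta_2)f\left(\tfrac{a+b}{2},d\right)\right]\\&+(\beta_2-\alpha_2)\left[(\alpha_1-a)f\left(a,\tfrac{c+d}{2}\right)+(b-\beta_1)f\left(b,\tfrac{c+d}{2}\right)\right].\end{aligned}$$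
   Context: Absolute continuity of a function of two variables is understood in the usual (Carathéodory) sense: $f:[a,b]\times[c,d]\to\mathbb{R}$ is absolutely continuous if there are Lebesgue integrable functions $g$ on $[a,b]$, $h$ on $[c,d]$ and $k$ on $[a,b]\times[c,d]$ with $f(t,s)=f(a,c)+\int_a^t g(u)\,du+\int_c^s h(v)\,dv+\int_a^t\int_c^s k(u,v)\,dv\,du$ for all $(t,s)\in[a,b]\times[c,d]$. *)

theory Defs
  imports "HOL-Analysis.Analysis"
begin

definition absolutely_continuous_rect ::
    "real \<Rightarrow> real \<Rightarrow> real \<Rightarrow> real \<Rightarrow> (real \<Rightarrow> real \<Rightarrow> real) \<Rightarrow> bool" where
  "absolutely_continuous_rect a b c d f \<longleftrightarrow>
     (\<exists>(g :: real \<Rightarrow> real) (h :: real \<Rightarrow> real) (k :: real \<times> real \<Rightarrow> real).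
        g absolutely_integrable_on {a..b} \<and>
        h absolutely_integrable_on {c..d} \<and>
        k absolutely_integrable_on {a..b} \<times> {c..d} \<and>
        (\<forall>t\<in>{a..b}. \<forall>s\<in>{c..d}.
           f t s = f a c + (LINT u:{a..t}|lebesgue. g u) + (LINT v:{c..s}|lebesgue. h v)
             + (LINT u:{a..t}|lebesgue. (LINT v:{c..s}|lebesgue. k (u, v)))))"

(* Derivatives are taken within the closed intervals, hence are one-sided at the
   endpoints; values of f outside the rectangle play no role. *)

definition partial_s :: "real \<Rightarrow> real \<Rightarrow> (real \<Rightarrow> real \<Rightarrow> real) \<Rightarrow> real \<Rightarrow> real \<Rightarrow> real" where
  "partial_s c d f t s = vector_derivative (\<lambda>v. f t v) (at s within {c..d})"

definition partial_ts ::
    "real \<Rightarrow> real \<Rightarrow> real \<Rightarrow> real \<Rightarrow> (real \<Rightarrow> real \<Rightarrow> real) \<Rightarrow> real \<Rightarrow> real \<Rightarrow> real" where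
  "partial_ts a b c d f t s =
     vector_derivative (\<lambda>u. partial_s c d f u s) (at t within {a..b})"

definition partial_ts_exists ::
    "real \<Rightarrow> real \<Rightarrow> real \<Rightarrow> real \<Rightarrow> (real \<Rightarrow> real \<Rightarrow> real) \<Rightarrow> bool" where
  "partial_ts_exists a b c d f \<longleftrightarrow>
     (\<forall>t\<in>{a..b}. \<forall>s\<in>{c..d}.
        (\<lambda>v. f t v) differentiable (at s within {c..d}) \<and>
        (\<lambda>u. partial_s c d f u s) differentiable (at t within {a..b}))"

(* SUP over the reals is only meaningful for a bounded family, so finiteness of the
   supremum is the separate predicate partial_ts_bounded. *)

definition partial_ts_bounded ::
    "real \<Rightarrow> real \<Rightarrow> real \<Rightarrow> real \<Rightarrow> (real \<Rightarrow> real \<Rightarrow> real) \<Rightarrow> bool" where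
  "partial_ts_bounded a b c d f \<longleftrightarrow>
     bdd_above ((\<lambda>(t, s). \<bar>partial_ts a b c d f t s\<bar>) ` ({a<..<b} \<times> {c<..<d}))"

definition partial_ts_norm ::
    "real \<Rightarrow> real \<Rightarrow> real \<Rightarrow> real \<Rightarrow> (real \<Rightarrow> real \<Rightarrow> real) \<Rightarrow> real" where
  "partial_ts_norm a b c d f =
     (SUP (t, s) \<in> {a<..<b} \<times> {c<..<d}. \<bar>partial_ts a b c d f t s\<bar>)"

definition H_term ::
    "real \<Rightarrow> real \<Rightarrow> real \<Rightarrow> real \<Rightarrow> (real \<Rightarrow> real \<Rightarrow> real) \<Rightarrow>
     real \<Rightarrow> real \<Rightarrow> real \<Rightarrow> real \<Rightarrow> real" where
  "H_term a b c d f \<alpha>1 \<alpha>2 \<beta>1 \<beta>2 =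
     (\<alpha>1 - a) * ((\<alpha>2 - c) * f a c + (d - \<beta>2) * f a d)
     + (b - \<beta>1) * ((\<alpha>2 - c) * f b c + (d - \<beta>2) * f b d)"

definition G_term ::
    "real \<Rightarrow> real \<Rightarrow> real \<Rightarrow> real \<Rightarrow> (real \<Rightarrow> real \<Rightarrow> real) \<Rightarrow>
     real \<Rightarrow> real \<Rightarrow> real \<Rightarrow> real \<Rightarrow> real" where
  "G_term a b c d f \<alpha>1 \<alpha>2 \<beta>1 \<beta>2 =
     (\<beta>1 - \<alpha>1) * ((\<alpha>2 - c) * f ((a + b) / 2) c + (d - \<beta>2) * f ((a + b) / 2) d)
     + (\<beta>2 - \<alpha>2) * ((\<alpha>1 - a) * f a ((c + d) / 2) + (b - \<beta>1) * f b ((c + d) / 2))"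

end

theory Submission
  imports Defs
begin

text \<open>
  Let \<open>L\<^sub>1\<close>, \<open>L\<^sub>2\<close> be the errors of the three-point quadrature rules on \<open>[a,b]\<close> and \<open>[c,d]\<close>. The
  expression to be bounded is \<open>L\<^sub>1\<close> applied to \<open>t \<mapsto> L\<^sub>2 (f t)\<close>. Each error is at most an explicit
  constant times a Lipschitz constant of the function. By the mean value theorem in \<open>t\<close> and then
  in \<open>s\<close>, \<open>f t - f t'\<close> is Lipschitz with constant \<open>M * \<bar>t - t'\<bar>\<close>, where \<open>M\<close> is the norm of the
  mixed derivative; hence \<open>t \<mapsto> L\<^sub>2 (f t)\<close> is Lipschitz and the one-dimensional estimate applies
  twice. Absolute continuity is needed only to make \<open>f t c\<close> continuous in \<open>t\<close>.
\<close>

section \<open>Quadrature errors for Lipschitz functions of one variable\<close>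

lemma lipschitz_on_vector_derivative_bound:
  fixes g g' :: "real \<Rightarrow> real"
  assumes "\<And>x. x \<in> {a..b} \<Longrightarrow> (g has_vector_derivative g' x) (at x within {a..b})"
    and "\<And>x. x \<in> {a<..<b} \<Longrightarrow> \<bar>g' x\<bar> \<le> K" and "0 \<le> K"
  shows "K-lipschitz_on {a..b} g"
proof -
  have ordered: "dist (g y) (g x) \<le> K * dist y x" if "x \<in> {a..b}" "y \<in> {a..b}" "x < y" for x y
  proof -
    have "(g has_derivative (\<lambda>h. h *\<^sub>R g' z)) (at z within {x..y})" if "z \<in> {x..y}" for z
      using assms(1)[of z] that \<open>x \<in> {a..b}\<close> \<open>y \<in> {a..b}\<close>
      by (auto simp: has_vector_derivative_def intro: has_derivative_subset)
    \<comment> \<open>The mean value point is strictly inside, so bounding \<open>g'\<close> on the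
      open interval suffices; this matches the norm, a supremum over the open rectangle.\<close>
    then obtain z where z: "z \<in> {x<..<y}" "g y - g x = (y - x) *\<^sub>R g' z"
      using mvt_simple[OF \<open>x < y\<close>, of g "\<lambda>z h. h *\<^sub>R g' z"] by auto
    then have "\<bar>g' z\<bar> \<le> K"
      using assms(2) that by auto
    then show ?thesis
      using z(2) \<open>x < y\<close> by (simp add: dist_real_def abs_mult mult_right_mono mult.commute)
  qed
  show ?thesis
  proof (rule lipschitz_onI)
    fix x y assume "x \<in> {a..b}" "y \<in> {a..b}"
    then show "dist (g x) (g y) \<le> K * dist x y"
      using ordered[of x y] ordered[of y x] by (cases x y rule: linorder_cases) (auto simp: dist_commute)
  qed fact
qed

text \<open>The error is the integral of \<open>\<phi> p - \<phi> t\<close>, which is at most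
  \<open>K * (t - p)\<close> in absolute value.\<close>

lemma left_rectangle_rule_error:
  fixes \<phi> :: "real \<Rightarrow> real"
  assumes "p \<le> q" and lip: "K-lipschitz_on {p..q} \<phi>"
  shows "\<bar>(q - p) * \<phi> p - integral {p..q} \<phi>\<bar> \<le> K * (q - p)\<^sup>2 / 2"
proof -
  have int: "\<phi> integrable_on {p..q}"
    using lipschitz_on_continuous_on[OF lip] by (rule integrable_continuous_real)
  have slope: "((\<lambda>t. K * (t - p)) has_integral K * ((q - p)\<^sup>2 / 2)) {p..q}"
    using fundamental_theorem_of_calculus[OF \<open>p \<le> q\<close>, of "\<lambda>t. K * ((t - p)\<^sup>2 / 2)" "\<lambda>t. K * (t - p)"]
    by (force intro!: derivative_eq_intros simp flip: has_real_derivative_iff_has_vector_derivative)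
  moreover have "\<phi> p - \<phi> t \<le> K * (t - p) \<and> \<phi> t - \<phi> p \<le> K * (t - p)" if "t \<in> {p..q}" for t
    using lipschitz_onD[OF lip, of p t] that by (auto simp: dist_real_def)
  ultimately have "norm (integral {p..q} (\<lambda>t. \<phi> p - \<phi> t)) \<le> integral {p..q} (\<lambda>t. K * (t - p))"
    by (intro integral_norm_bound_integral) (auto intro!: integrable_diff int simp: abs_le_iff)
  also have "\<dots> = K * (q - p)\<^sup>2 / 2"
    using integral_unique[OF slope] by simp
  also have "integral {p..q} (\<lambda>t. \<phi> p - \<phi> t) = (q - p) * \<phi> p - integral {p..q} \<phi>"
    using \<open>p \<le> q\<close> int
    by (subst Henstock_Kurzweil_Integration.integral_diff) auto
  finally show ?thesis
    by simp
qed

lemma right_rectangle_rule_error: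
  fixes \<phi> :: "real \<Rightarrow> real"
  assumes "p \<le> q" and lip: "K-lipschitz_on {p..q} \<phi>"
  shows "\<bar>(q - p) * \<phi> q - integral {p..q} \<phi>\<bar> \<le> K * (q - p)\<^sup>2 / 2"
proof -
  \<comment> \<open>Reflection swaps the endpoints and reduces to the left rule.\<close>
  have "K-lipschitz_on {-q..-p} (\<lambda>t. \<phi> (-t))"
    using lip by (auto simp: lipschitz_on_def dist_real_def)
      (smt (verit, best) atLeastAtMost_iff)
  from left_rectangle_rule_error[OF _ this] \<open>p \<le> q\<close> show ?thesis
    by simp
qed

text \<open>For \<open>x\<close> in the interval, cut at \<open>x\<close> and use the left rule
  before it and the right rule after it. Points \<open>x\<close> outside are covered too, because
  \<open>\<alpha>\<close> and \<open>\<beta>\<close> may lie on the same side of the midpoint when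
  the rule is applied to half intervals.\<close>

lemma two_point_rule_error:
  fixes \<phi> :: "real \<Rightarrow> real"
  assumes "p \<le> q" and lip: "K-lipschitz_on {p..q} \<phi>"
  shows "\<bar>(x - p) * \<phi> p + (q - x) * \<phi> q - integral {p..q} \<phi>\<bar> \<le> K * (((x - p)\<^sup>2 + (q - x)\<^sup>2) / 2)"
proof -
  have K: "0 \<le> K"
    using lip by (rule lipschitz_on_nonneg)
  have ends: "\<bar>\<phi> p - \<phi> q\<bar> \<le> K * (q - p)"
    using lipschitz_onD[OF lip, of p q] \<open>p \<le> q\<close> by (simp add: dist_real_def)
  consider "x < p" | "p \<le> x" "x \<le> q" | "q < x"
    by linarith
  then show ?thesis
  proof cases
    case 1
    have "(x - p) * \<phi> p + (q - x) * \<phi> q - integral {p..q} \<phi>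
        = ((q - p) * \<phi> q - integral {p..q} \<phi>) + (p - x) * (\<phi> q - \<phi> p)"
      by (simp add: algebra_simps)
    moreover have "\<bar>(p - x) * (\<phi> q - \<phi> p)\<bar> \<le> (p - x) * (K * (q - p))"
      using ends 1 by (simp add: abs_mult abs_minus_commute)
    \<comment> \<open>The right rule plus a multiple of the endpoint difference beats the claimed
      bound by exactly \<open>K * (x - p)\<^sup>2\<close>.\<close>
    moreover have "K * (q - p)\<^sup>2 / 2 + (p - x) * (K * (q - p)) + K * (x - p)\<^sup>2
        = K * (((x - p)\<^sup>2 + (q - x)\<^sup>2) / 2)"
      by (simp add: power2_eq_square field_simps)
    moreover have "0 \<le> K * (x - p)\<^sup>2"
      using K by simp
    ultimately show ?thesis
      using right_rectangle_rule_error[OF assms] by linarith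
  next
    case 2
    have "integral {p..q} \<phi> = integral {p..x} \<phi> + integral {x..q} \<phi>"
      using 2 integrable_continuous_real[OF lipschitz_on_continuous_on[OF lip]]
      by (simp add: Henstock_Kurzweil_Integration.integral_combine)
    moreover have "\<bar>(x - p) * \<phi> p - integral {p..x} \<phi>\<bar> \<le> K * (x - p)\<^sup>2 / 2"
      using 2 by (intro left_rectangle_rule_error lipschitz_on_subset[OF lip]) auto
    moreover have "\<bar>(q - x) * \<phi> q - integral {x..q} \<phi>\<bar> \<le> K * (q - x)\<^sup>2 / 2"
      using 2 by (intro right_rectangle_rule_error lipschitz_on_subset[OF lip]) auto
    moreover have "K * (x - p)\<^sup>2 / 2 + K * (q - x)\<^sup>2 / 2 = K * (((x - p)\<^sup>2 + (q - x)\<^sup>2) / 2)"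
      by (simp add: algebra_simps add_divide_distrib)
    ultimately show ?thesis
      by linarith
  next
    case 3
    have "(x - p) * \<phi> p + (q - x) * \<phi> q - integral {p..q} \<phi>
        = ((q - p) * \<phi> p - integral {p..q} \<phi>) + (x - q) * (\<phi> p - \<phi> q)"
      by (simp add: algebra_simps)
    moreover have "\<bar>(x - q) * (\<phi> p - \<phi> q)\<bar> \<le> (x - q) * (K * (q - p))"
      using ends 3 by (simp add: abs_mult)
    moreover have "K * (q - p)\<^sup>2 / 2 + (x - q) * (K * (q - p)) + K * (q - x)\<^sup>2
        = K * (((x - p)\<^sup>2 + (q - x)\<^sup>2) / 2)"
      by (simp add: power2_eq_square field_simps)
    moreover have "0 \<le> K * (q - x)\<^sup>2"
      using K by simp
    ultimately show ?thesis
      using left_rectangle_rule_error[OF assms] by linarith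
  qed
qed

definition three_point_error ::
    "real \<Rightarrow> real \<Rightarrow> real \<Rightarrow> real \<Rightarrow> (real \<Rightarrow> real) \<Rightarrow> real" where
  "three_point_error a b \<alpha> \<beta> \<phi> =
     (\<beta> - \<alpha>) * \<phi> ((a + b) / 2) + (\<alpha> - a) * \<phi> a + (b - \<beta>) * \<phi> b - integral {a..b} \<phi>"

text \<open>With m the midpoint and \<alpha> \<le> m \<le> \<beta>, this is the integral of |t -
  \<alpha>| over [a,m] plus that of |t - \<beta>| over [m,b]. The eighths come from halving (m -
  \<alpha>)^2 and (\<beta> - m)^2.\<close>

definition three_point_const :: "real \<Rightarrow> real \<Rightarrow> real \<Rightarrow> real \<Rightarrow> real" where
  "three_point_const a b \<alpha> \<beta> =
     ((\<alpha> - a)\<^sup>2 + (b - \<beta>)\<^sup>2) / 2 + ((a + b - 2 * \<alpha>)\<^sup>2 + (a + b - 2 * \<beta>)\<^sup>2) / 8"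

lemma three_point_const_nonneg: "0 \<le> three_point_const a b \<alpha> \<beta>"
  by (simp add: three_point_const_def)

text \<open>The rule is the sum of two-point rules on the two halves, with parameters
  \<open>\<alpha>\<close> and \<open>\<beta>\<close>; the midpoint gets weight (m - \<alpha>) +
  (\<beta> - m) = \<beta> - \<alpha>.\<close>

lemma three_point_error_bound:
  assumes "a \<le> b" and lip: "K-lipschitz_on {a..b} \<phi>"
  shows "\<bar>three_point_error a b \<alpha> \<beta> \<phi>\<bar> \<le> three_point_const a b \<alpha> \<beta> * K"
proof -
  define m where "m = (a + b) / 2"
  have m: "a \<le> m" "m \<le> b"
    using \<open>a \<le> b\<close> by (auto simp: m_def)
  have "integral {a..b} \<phi> = integral {a..m} \<phi> + integral {m..b} \<phi>"
    using m integrable_continuous_real[OF lipschitz_on_continuous_on[OF lip]]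
    by (simp add: Henstock_Kurzweil_Integration.integral_combine)
  then have "three_point_error a b \<alpha> \<beta> \<phi>
      = ((\<alpha> - a) * \<phi> a + (m - \<alpha>) * \<phi> m - integral {a..m} \<phi>)
        + ((\<beta> - m) * \<phi> m + (b - \<beta>) * \<phi> b - integral {m..b} \<phi>)"
    by (simp add: three_point_error_def algebra_simps flip: m_def)
  moreover have "\<bar>(\<alpha> - a) * \<phi> a + (m - \<alpha>) * \<phi> m - integral {a..m} \<phi>\<bar>
      \<le> K * (((\<alpha> - a)\<^sup>2 + (m - \<alpha>)\<^sup>2) / 2)"
    using m by (intro two_point_rule_error lipschitz_on_subset[OF lip]) auto
  moreover have "\<bar>(\<beta> - m) * \<phi> m + (b - \<beta>) * \<phi> b - integral {m..b} \<phi>\<bar>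
      \<le> K * (((\<beta> - m)\<^sup>2 + (b - \<beta>)\<^sup>2) / 2)"
    using m by (intro two_point_rule_error lipschitz_on_subset[OF lip]) auto
  moreover have "K * (((\<alpha> - a)\<^sup>2 + (m - \<alpha>)\<^sup>2) / 2) + K * (((\<beta> - m)\<^sup>2 + (b - \<beta>)\<^sup>2) / 2)
      = three_point_const a b \<alpha> \<beta> * K"
    by (simp add: three_point_const_def m_def power2_eq_square field_simps)
  ultimately show ?thesis
    by linarith
qed

lemma three_point_error_diff:
  assumes "\<phi> integrable_on {a..b}" "\<psi> integrable_on {a..b}"
  shows "three_point_error a b \<alpha> \<beta> (\<lambda>x. \<phi> x - \<psi> x)
    = three_point_error a b \<alpha> \<beta> \<phi> - three_point_error a b \<alpha> \<beta> \<psi>"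
  using assms by (simp add: three_point_error_def integral_diff algebra_simps)

section \<open>Lebesgue and gauge integrals, and regularity of \<open>f\<close> on the
  rectangle\<close>

lemma set_lebesgue_integral_continuous_on:
  fixes \<phi> :: "real \<Rightarrow> real"
  assumes "continuous_on {a..b} \<phi>"
  shows "(LINT t:{a..b}|lebesgue. \<phi> t) = integral {a..b} \<phi>"
  using absolutely_integrable_continuous_real[OF assms] by (rule set_lebesgue_integral_eq_integral)

text \<open>Adding a function of t alone to \<open>f\<close> leaves the mixed derivative unchanged,
  so continuity in t must come from the integral representation. At s = c only the indefinite
  integral of \<open>g\<close> survives.\<close>

lemma absolutely_continuous_rect_continuous_on_edge:
  assumes ac: "absolutely_continuous_rect a b c d f" and "c \<le> d"
  shows "continuous_on {a..b} (\<lambda>t. f t c)"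
proof -
  obtain g h k where g: "g absolutely_integrable_on {a..b}"
    and f: "\<And>t s. t \<in> {a..b} \<Longrightarrow> s \<in> {c..d} \<Longrightarrow>
      f t s = f a c + (LINT u:{a..t}|lebesgue. g u) + (LINT v:{c..s}|lebesgue. h v)
        + (LINT u:{a..t}|lebesgue. (LINT v:{c..s}|lebesgue. k (u, v)))"
    using ac unfolding absolutely_continuous_rect_def by blast
  \<comment> \<open>For arbitrary \<open>w\<close>, so that every section of \<open>k\<close> is
    covered, integrable or not.\<close>
  have null: "(LINT v:{c..c}|lebesgue. w v) = 0" for w :: "real \<Rightarrow> real"
  proof -
    have "w absolutely_integrable_on {c..c}"
      by (rule absolutely_integrable_negligible) simp
    then show ?thesis
      by (simp add: set_lebesgue_integral_eq_integral)
  qed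
  have "f t c = f a c + integral {a..t} g" if "t \<in> {a..b}" for t
  proof -
    have "(LINT u:{a..t}|lebesgue. g u) = integral {a..t} g"
      using that by (intro set_lebesgue_integral_eq_integral set_integrable_subset[OF g]) auto
    then show ?thesis
      using f[OF that, of c] \<open>c \<le> d\<close> null by simp
  qed
  moreover have "continuous_on {a..b} (\<lambda>t. f a c + integral {a..t} g)"
    using g by (intro continuous_intros indefinite_integral_continuous_1)
      (rule set_lebesgue_integral_eq_integral)
  ultimately show ?thesis
    by (metis (no_types, lifting) continuous_on_cong)
qed

lemma lipschitz_on_section_diff:
  assumes "a < b" "c < d"
    and ex: "partial_ts_exists a b c d f" and bdd: "partial_ts_bounded a b c d f"
    and t: "t \<in> {a..b}" "t' \<in> {a..b}"
  shows "(partial_ts_norm a b c d f * \<bar>t - t'\<bar>)-lipschitz_on {c..d} (\<lambda>s. f t s - f t' s)"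
proof -
  let ?M = "partial_ts_norm a b c d f"
  have bound: "\<bar>partial_ts a b c d f u s\<bar> \<le> ?M" if "u \<in> {a<..<b}" "s \<in> {c<..<d}" for u s
    using bdd that unfolding partial_ts_norm_def partial_ts_bounded_def
    by (intro cSUP_upper2[of _ _ "(u, s)"]) auto
  have M: "0 \<le> ?M"
    using bound[of "(a + b) / 2" "(c + d) / 2"] assms(1,2) by (simp add: field_simps)
  show ?thesis
  proof (rule lipschitz_on_vector_derivative_bound)
    show "((\<lambda>s. f t s - f t' s) has_vector_derivative partial_s c d f t s - partial_s c d f t' s)
        (at s within {c..d})" if "s \<in> {c..d}" for s
      using ex t that unfolding partial_ts_exists_def partial_s_def
      by (intro has_vector_derivative_diff) (auto simp: vector_derivative_works)
    show "\<bar>partial_s c d f t s - partial_s c d f t' s\<bar> \<le> ?M * \<bar>t - t'\<bar>" if "s \<in> {c<..<d}" for s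
    proof -
      \<comment> \<open>For fixed interior \<open>s\<close>, the mean value estimate in the first
        variable bounds the s-derivative of the difference of sections.\<close>
      have "?M-lipschitz_on {a..b} (\<lambda>u. partial_s c d f u s)"
      proof (rule lipschitz_on_vector_derivative_bound[where g' = "\<lambda>u. partial_ts a b c d f u s"])
        show "((\<lambda>u. partial_s c d f u s) has_vector_derivative partial_ts a b c d f u s)
            (at u within {a..b})" if "u \<in> {a..b}" for u
          using ex that \<open>s \<in> {c<..<d}\<close> unfolding partial_ts_exists_def partial_ts_def
          by (auto simp: vector_derivative_works)
      qed (use bound M that in auto)
      from lipschitz_onD[OF this t] show ?thesis
        by (simp add: dist_real_def)
    qed
    show "0 \<le> ?M * \<bar>t - t'\<bar>"
      using M by simp
  qed
qed

section \<open>The two-variable inequality by iterating the one-variable estimate\<close>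

theorem theorem3:
  fixes a b c d \<alpha>1 \<alpha>2 \<beta>1 \<beta>2 :: real and f :: "real \<Rightarrow> real \<Rightarrow> real"
  assumes "a < b" and "c < d"
    and "absolutely_continuous_rect a b c d f"
    and "partial_ts_exists a b c d f"
    and "partial_ts_bounded a b c d f"
    and "(\<alpha>1, \<alpha>2) \<in> {a..b} \<times> {c..d}" and "(\<beta>1, \<beta>2) \<in> {a..b} \<times> {c..d}"
    and "\<alpha>1 < \<beta>1" and "\<alpha>2 < \<beta>2"
  shows
    "\<bar>(\<beta>1 - \<alpha>1) * (\<beta>2 - \<alpha>2) * f ((a + b) / 2) ((c + d) / 2)
        + H_term a b c d f \<alpha>1 \<alpha>2 \<beta>1 \<beta>2 + G_term a b c d f \<alpha>1 \<alpha>2 \<beta>1 \<beta>2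
        - (\<beta>2 - \<alpha>2) * (LINT t:{a..b}|lebesgue. f t ((c + d) / 2))
        - (\<beta>1 - \<alpha>1) * (LINT s:{c..d}|lebesgue. f ((a + b) / 2) s)
        - (LINT t:{a..b}|lebesgue. ((\<alpha>2 - c) * f t c + (d - \<beta>2) * f t d))
        - (LINT s:{c..d}|lebesgue. ((\<alpha>1 - a) * f a s + (b - \<beta>1) * f b s))
        + (LINT t:{a..b}|lebesgue. (LINT s:{c..d}|lebesgue. f t s))\<bar>
     \<le> (((\<alpha>1 - a)\<^sup>2 + (b - \<beta>1)\<^sup>2) / 2
          + ((a + b - 2 * \<alpha>1)\<^sup>2 + (a + b - 2 * \<beta>1)\<^sup>2) / 8)
        * (((\<alpha>2 - c)\<^sup>2 + (d - \<beta>2)\<^sup>2) / 2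
          + ((c + d - 2 * \<alpha>2)\<^sup>2 + (c + d - 2 * \<beta>2)\<^sup>2) / 8)
        * partial_ts_norm a b c d f"
proof -
  let ?M = "partial_ts_norm a b c d f" and ?m = "(a + b) / 2" and ?n = "(c + d) / 2"
  define \<Phi> where "\<Phi> t = three_point_error c d \<alpha>2 \<beta>2 (f t)" for t
  note lip_diff = lipschitz_on_section_diff[OF assms(1,2,4,5)]
  have M: "0 \<le> ?M"
    using lipschitz_on_nonneg[OF lip_diff[of a b]] assms(1) by (simp add: zero_le_mult_iff)
  have cont_s: "continuous_on {c..d} (f t)" if "t \<in> {a..b}" for t
    using assms(4) that unfolding partial_ts_exists_def continuous_on_eq_continuous_within
    by (auto intro: differentiable_imp_continuous_within)
  have int_s: "f t integrable_on {c..d}" if "t \<in> {a..b}" for t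
    using cont_s[OF that] by (rule integrable_continuous_real)
  have edge: "continuous_on {a..b} (\<lambda>t. f t c)"
    using assms(2,3) by (intro absolutely_continuous_rect_continuous_on_edge) auto
  have cont_t: "continuous_on {a..b} (\<lambda>t. f t s)" if s: "s \<in> {c..d}" for s
  proof -
    \<comment> \<open>The estimate on section differences bounds a mixed second difference of
      \<open>f\<close>, so it can also be read as a Lipschitz bound in t.\<close>
    have "(?M * (s - c))-lipschitz_on {a..b} (\<lambda>t. f t s - f t c)"
    proof (rule lipschitz_onI)
      fix t t' assume "t \<in> {a..b}" "t' \<in> {a..b}"
      from lipschitz_onD[OF lip_diff[OF this] s, of c] s
      show "dist (f t s - f t c) (f t' s - f t' c) \<le> ?M * (s - c) * dist t t'"
        by (simp add: dist_real_def algebra_simps)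
    qed (use M s in simp)
    from continuous_on_add[OF lipschitz_on_continuous_on[OF this] edge] show ?thesis
      by simp
  qed
  have lip: "(three_point_const c d \<alpha>2 \<beta>2 * ?M)-lipschitz_on {a..b} \<Phi>"
  proof (rule lipschitz_onI)
    fix t t' assume t: "t \<in> {a..b}" "t' \<in> {a..b}"
    \<comment> \<open>Linearity of the error turns an increment of \<open>\<Phi>\<close> into the
      error of a section difference, whose Lipschitz constant is known.\<close>
    have "\<Phi> t - \<Phi> t' = three_point_error c d \<alpha>2 \<beta>2 (\<lambda>s. f t s - f t' s)"
      unfolding \<Phi>_def using t by (simp add: three_point_error_diff int_s)
    then show "dist (\<Phi> t) (\<Phi> t') \<le> three_point_const c d \<alpha>2 \<beta>2 * ?M * dist t t'"
      using three_point_error_bound[OF _ lip_diff[OF t], of \<alpha>2 \<beta>2] assms(2)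
      by (simp add: dist_real_def mult.assoc)
  qed (use M in \<open>simp add: three_point_const_nonneg\<close>)
  let ?J = "\<lambda>t. integral {c..d} (f t)"
  have mem: "c \<in> {c..d}" "d \<in> {c..d}" "?n \<in> {c..d}" "a \<in> {a..b}" "b \<in> {a..b}" "?m \<in> {a..b}"
    using assms(1,2) by auto
  \<comment> \<open>Solving the definition of \<open>\<Phi>\<close> for the inner integral gives its
    continuity in t without joint continuity of \<open>f\<close>.\<close>
  have J_eq: "?J t = (\<beta>2 - \<alpha>2) * f t ?n + ((\<alpha>2 - c) * f t c + (d - \<beta>2) * f t d) - \<Phi> t" for t
    by (simp add: \<Phi>_def three_point_error_def)
  have cont_J: "continuous_on {a..b} ?J"
    unfolding J_eq
    by (intro continuous_intros cont_t mem lipschitz_on_continuous_on[OF lip])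
  have cont_edges: "continuous_on {a..b} (\<lambda>t. (\<alpha>2 - c) * f t c + (d - \<beta>2) * f t d)"
    by (intro continuous_intros cont_t mem)
  have int_t: "(\<lambda>t. f t s) integrable_on {a..b}" if "s \<in> {c..d}" for s
    using cont_t[OF that] by (rule integrable_continuous_real)
  have int_edges: "(\<lambda>t. (\<alpha>2 - c) * f t c + (d - \<beta>2) * f t d) integrable_on {a..b}"
    using cont_edges by (rule integrable_continuous_real)
  have "integral {a..b} \<Phi> = integral {a..b} (\<lambda>t. (\<beta>2 - \<alpha>2) * f t ?n
      + ((\<alpha>2 - c) * f t c + (d - \<beta>2) * f t d) - ?J t)"
    by (simp add: J_eq)
  also have "\<dots> = (\<beta>2 - \<alpha>2) * integral {a..b} (\<lambda>t. f t ?n)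
      + integral {a..b} (\<lambda>t. (\<alpha>2 - c) * f t c + (d - \<beta>2) * f t d) - integral {a..b} ?J"
    using integrable_on_cmult_left[OF int_t[OF mem(3)], of "\<beta>2 - \<alpha>2"] int_edges
      integrable_continuous_real[OF cont_J]
    by (simp add: integral_diff integral_add integrable_add)
  finally have int_\<Phi>: "integral {a..b} \<Phi> = \<dots>" .
  have "integral {c..d} (\<lambda>s. (\<alpha>1 - a) * f a s + (b - \<beta>1) * f b s) = (\<alpha>1 - a) * ?J a + (b - \<beta>1) * ?J b"
    using integrable_on_cmult_left[OF int_s[OF mem(4)], of "\<alpha>1 - a"]
      integrable_on_cmult_left[OF int_s[OF mem(5)], of "b - \<beta>1"]
    by (simp add: integral_add)
  moreover have "continuous_on {c..d} (\<lambda>s. (\<alpha>1 - a) * f a s + (b - \<beta>1) * f b s)"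
    by (intro continuous_intros cont_s mem)
  ultimately have lint_b: "(LINT s:{c..d}|lebesgue. ((\<alpha>1 - a) * f a s + (b - \<beta>1) * f b s))
      = (\<alpha>1 - a) * ?J a + (b - \<beta>1) * ?J b"
    by (simp add: set_lebesgue_integral_continuous_on)
  have "(LINT t:{a..b}|lebesgue. (LINT s:{c..d}|lebesgue. f t s)) = (LINT t:{a..b}|lebesgue. ?J t)"
    by (intro set_lebesgue_integral_cong) (auto simp: set_lebesgue_integral_continuous_on cont_s)
  then have lint_double: "(LINT t:{a..b}|lebesgue. (LINT s:{c..d}|lebesgue. f t s)) = integral {a..b} ?J"
    using cont_J by (simp add: set_lebesgue_integral_continuous_on)
  have "\<bar>three_point_error a b \<alpha>1 \<beta>1 \<Phi>\<bar>
      \<le> three_point_const a b \<alpha>1 \<beta>1 * (three_point_const c d \<alpha>2 \<beta>2 * ?M)"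
    using assms(1) lip by (intro three_point_error_bound) auto
  \<comment> \<open>Expanding the outer error of the inner one: the nine node products give the
    centre value, \<open>H_term\<close> (corners) and \<open>G_term\<close> (edge midpoints); node
    times integral gives the single integrals, and the two minus signs make the double integral
    positive. Its order of integration is already the required one.\<close>
  moreover have "three_point_error a b \<alpha>1 \<beta>1 \<Phi>
      = (\<beta>1 - \<alpha>1) * (\<beta>2 - \<alpha>2) * f ?m ?n
        + H_term a b c d f \<alpha>1 \<alpha>2 \<beta>1 \<beta>2 + G_term a b c d f \<alpha>1 \<alpha>2 \<beta>1 \<beta>2
        - (\<beta>2 - \<alpha>2) * integral {a..b} (\<lambda>t. f t ?n)
        - (\<beta>1 - \<alpha>1) * ?J ?m
        - integral {a..b} (\<lambda>t. (\<alpha>2 - c) * f t c + (d - \<beta>2) * f t d)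
        - ((\<alpha>1 - a) * ?J a + (b - \<beta>1) * ?J b)
        + integral {a..b} ?J"
    unfolding three_point_error_def[of a] int_\<Phi> H_term_def G_term_def
    unfolding \<Phi>_def three_point_error_def
    by (simp add: algebra_simps)
  ultimately show ?thesis
    unfolding lint_b lint_double set_lebesgue_integral_continuous_on[OF cont_edges]
      set_lebesgue_integral_continuous_on[OF cont_t[OF mem(3)]]
      set_lebesgue_integral_continuous_on[OF cont_s[OF mem(6)]] three_point_const_def
    by (simp only: mult.assoc)
qed

end
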